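(* If $\Delta=\{\nu_k\}_{k\ge1}$ is an increasing sequence of positive integers with $$\gamma_\Delta=\sup_{k\in\mathbb N}(\nu_{k+1}-\nu_k)<\infty,$$ then $$\mathcal F(\mathcal{DR}^2_\Delta)=\mathcal F(\mathcal{DR}^2).$$
   Context: $\mathcal{DR}^2$ is the family of dyadic rectangles $\left[\frac{j_1-1}{2^{m_1}},\frac{j_1}{2^{m_1}}\right)\times\left[\frac{j_2-1}{2^{m_2}},\frac{j_2}{2^{m_2}}\right)$ with $j_1,j_2,m_1,m_2\in\mathbb Z$, and $\mathcal{DR}^2_\Delta$ is the subfamily with $m_1,m_2\in\Delta$. For a family $\mathcal B$ of bounded sets of positive measure in $\mathbb R^2$ such that every point is contained in members of arbitrarily small diameter (a differentiation basis), and $f\in L_{\rm loc}(\mathbb R^2)$ (locally integrable), set $$\delta_{\mathcal B}(x,f)=\limsup_{\mathrm{diam}(E)\to0,\ x\in E\in\mathcal B}\left|\frac1{|E|}\int_Ef(t)\,dt-f(x)\right| ,$$ and $\mathcal F(\mathcal B)=\{f\in L_{\rm loc}(\mathbb R^2):\ \delta_{\mathcal B}(x,f)=0\text{ for almost every }x\}$. *)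

theory Defs
  imports "HOL-Analysis.Analysis"
begin

definition locally_integrable :: "('a::euclidean_space \<Rightarrow> real) \<Rightarrow> bool" where
  "locally_integrable f \<longleftrightarrow> (\<forall>K. compact K \<longrightarrow> set_integrable lebesgue K f)"

definition differentiation_basis :: "'a::euclidean_space set set \<Rightarrow> bool" where
  "differentiation_basis B \<longleftrightarrow>
     (\<forall>E\<in>B. bounded E \<and> E \<in> sets lebesgue \<and> measure lebesgue E > 0) \<and>
     (\<forall>x. \<forall>e>0. \<exists>E\<in>B. x \<in> E \<and> diameter E < e)"

text \<open>The filter of members \<open>E\<close> of \<open>B\<close> containing \<open>x\<close>, as the diameter of \<open>E\<close> tends to 0. It is
  proper whenever \<open>B\<close> is a differentiation basis; the notions below are meant for such \<open>B\<close> only.\<close>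

definition shrinking_to :: "'a::euclidean_space set set \<Rightarrow> 'a \<Rightarrow> 'a set filter" where
  "shrinking_to B x = inf (filtercomap diameter (nhds 0)) (principal {E \<in> B. x \<in> E})"

definition osc :: "'a::euclidean_space set set \<Rightarrow> 'a \<Rightarrow> ('a \<Rightarrow> real) \<Rightarrow> ereal" where
  "osc B x f = Limsup (shrinking_to B x)
     (\<lambda>E. ereal \<bar>1 / measure lebesgue E * (LINT t:E|lebesgue. f t) - f x\<bar>)"

definition differentiated_by :: "'a::euclidean_space set set \<Rightarrow> ('a \<Rightarrow> real) set" where
  "differentiated_by B = {f. locally_integrable f \<and> (AE x in lebesgue. osc B x f = 0)}"

definition dyadic_rectangles :: "int set \<Rightarrow> (real \<times> real) set set" where
  "dyadic_rectangles \<Delta> =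
     {{(of_int j1 - 1) / 2 powi m1 ..< of_int j1 / 2 powi m1} \<times>
      {(of_int j2 - 1) / 2 powi m2 ..< of_int j2 / 2 powi m2}
      | (j1::int) (j2::int) m1 m2. m1 \<in> \<Delta> \<and> m2 \<in> \<Delta>}"

lemma eventually_shrinking_to:
  "eventually P (shrinking_to B x) \<longleftrightarrow>
     (\<exists>d>0. \<forall>E\<in>B. x \<in> E \<and> \<bar>diameter E\<bar> < d \<longrightarrow> P E)"
  unfolding shrinking_to_def eventually_inf_principal eventually_filtercomap eventually_nhds_metric
  by (auto simp: dist_real_def)

lemma differentiation_basis_dyadic_rectangles:
  assumes "\<And>n. \<exists>m\<in>\<Delta>. n \<le> m"
  shows "differentiation_basis (dyadic_rectangles \<Delta>)"
  unfolding differentiation_basis_def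
proof safe
  fix E assume "E \<in> dyadic_rectangles \<Delta>"
  then obtain j1 j2 m1 m2 where E: "E = {(of_int j1 - 1) / 2 powi m1 ..< of_int j1 / 2 powi m1} \<times>
      {(of_int j2 - 1) / 2 powi m2 ..< of_int j2 / 2 powi m2}"
    unfolding dyadic_rectangles_def by blast
  show "bounded E"
    unfolding E by (intro bounded_Times) auto
  have meas: "E \<in> sets lborel"
    unfolding E lborel_prod[symmetric] by (intro pair_measureI) auto
  then show "E \<in> sets lebesgue" by simp
  have "emeasure lborel E = ennreal (1 / 2 powi m1) * ennreal (1 / 2 powi m2)"
    unfolding E lborel_prod[symmetric]
    by (subst lborel.emeasure_pair_measure_Times) (auto simp: divide_right_mono diff_divide_distrib)
  also have "\<dots> = ennreal (1 / 2 powi m1 * (1 / 2 powi m2))"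
    by (rule ennreal_mult[symmetric]) auto
  finally show "measure lebesgue E > 0"
    using meas by (simp add: measure_def)
next
  fix x :: "real \<times> real" and e :: real assume e: "e > 0"
  obtain a b where x: "x = (a, b)" by force
  obtain k where k: "(1/2 :: real) ^ k < e / 4"
    using e real_arch_pow_inv[of "e/4" "1/2"] by auto
  obtain m where m: "m \<in> \<Delta>" "int k \<le> m" using assms by blast
  define q :: real where "q = 2 powi m"
  have q: "q > 0" by (simp add: q_def)
  have "2 ^ k \<le> q"
    using power_int_increasing[of "int k" m "2::real"] m by (simp add: q_def)
  then have qe: "1 / q < e / 4"
    using k by (smt (verit) frac_le power_one_over zero_less_power)
  define E where "E = {(of_int (\<lfloor>q*a\<rfloor>+1) - 1) / q ..< of_int (\<lfloor>q*a\<rfloor>+1) / q} \<times>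
      {(of_int (\<lfloor>q*b\<rfloor>+1) - 1) / q ..< of_int (\<lfloor>q*b\<rfloor>+1) / q}"
  have "E \<in> dyadic_rectangles \<Delta>"
    unfolding dyadic_rectangles_def E_def q_def using m by blast
  moreover have "x \<in> E"
    unfolding E_def x using q by (auto simp: field_simps) linarith+
  moreover have "diameter E \<le> e / 2"
  proof (rule diameter_le)
    fix y z assume "y \<in> E" "z \<in> E"
    then have "\<bar>fst y - fst z\<bar> \<le> 1 / q" "\<bar>snd y - snd z\<bar> \<le> 1 / q"
      by (auto simp: E_def add_divide_distrib)
    then show "norm (y - z) \<le> e / 2"
      using qe norm_Pair_le[of "fst y - fst z" "snd y - snd z"] by (simp add: minus_prod_def)
  qed (use e in auto)
  ultimately show "\<exists>E\<in>dyadic_rectangles \<Delta>. x \<in> E \<and> diameter E < e"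
    using e by force
qed

end

theory Submission
  imports Defs
begin

text \<open>
  Only the inclusion from left to right needs an argument. Suppose that the averages of \<open>f\<close> over
  rectangles with levels in \<open>\<Delta>\<close> converge almost everywhere, and fix \<open>e > 0\<close>. For a rational \<open>c\<close> and a
  level \<open>N\<close> let \<open>A\<close> be the set of points where \<open>f\<close> is within \<open>e\<close> of \<open>c\<close> and where all averages over
  \<open>\<Delta>\<close>-rectangles of levels at least \<open>N\<close> are within \<open>e\<close> of \<open>f\<close>. These countably many sets cover almost
  every point. Let \<open>R\<close> be an arbitrary small dyadic rectangle containing a point \<open>x\<close> of \<open>A\<close>. As the gaps
  of \<open>\<Delta>\<close> are at most some \<open>G\<close>, the rectangle \<open>R\<close> splits into at most \<open>4 ^ G\<close> congruent
  \<open>\<Delta>\<close>-rectangles. If \<open>A\<close> fills a proportion of more than \<open>1 - 1 / 4 ^ G\<close> of \<open>R\<close>, then each of these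
  pieces meets \<open>A\<close>, so its average is within \<open>2 * e\<close> of \<open>c\<close>; therefore so is the average over \<open>R\<close>, which
  is then within \<open>3 * e\<close> of \<open>f x\<close> (\<open>average_near_if_pieces_meet\<close>, \<open>AE_averages_close_all_levels\<close>).

  That \<open>A\<close> does fill such a proportion of all sufficiently small dyadic rectangles around almost every
  point of \<open>A\<close>, with no restriction on the ratio of the sides, is the strong density theorem
  \<open>AE_strong_dyadic_density\<close>. It follows by applying the one-dimensional theorem \<open>AE_dyadic_dense\<close>
  first to the horizontal sections of the set, and then to the vertical sections of the set of points
  where the first application gives a uniform bound.
\<close>

section \<open>Dyadic intervals\<close>

definition dyad :: "nat \<Rightarrow> int \<Rightarrow> real set" where
  "dyad m j = {of_int j / 2 ^ m ..< (of_int j + 1) / 2 ^ m}"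

lemma mem_dyad_iff: "x \<in> dyad m j \<longleftrightarrow> \<lfloor>x * 2 ^ m\<rfloor> = j"
  by (auto simp: dyad_def floor_eq_iff field_simps)

lemma dyad_sets [measurable]: "dyad m j \<in> sets borel"
  by (simp add: dyad_def)

lemma emeasure_dyad: "emeasure lborel (dyad m j) = ennreal (1 / 2 ^ m)"
proof -
  have "(of_int j + 1) / 2 ^ m - of_int j / 2 ^ m = (1 / 2 ^ m :: real)"
    by (simp add: diff_divide_distrib [symmetric])
  moreover have "real_of_int j / 2 ^ m \<le> (of_int j + 1) / 2 ^ m"
    by (simp add: divide_right_mono)
  ultimately show ?thesis by (simp add: dyad_def)
qed

lemma dyad_ancestor:
  assumes "x \<in> dyad (m + p) i"
  shows "x \<in> dyad m (i div 2 ^ p)"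
proof -
  have "\<lfloor>x * 2 ^ m\<rfloor> = \<lfloor>x * 2 ^ (m + p) / real_of_int (2 ^ p)\<rfloor>"
    by (simp add: power_add)
  also have "\<dots> = \<lfloor>x * 2 ^ (m + p)\<rfloor> div 2 ^ p"
    by (rule floor_divide_real_eq_div) simp
  finally show ?thesis using assms by (simp add: mem_dyad_iff)
qed

lemma dyad_nested:
  assumes "m \<le> m'" "x \<in> dyad m j" "x \<in> dyad m' j'"
  shows "dyad m' j' \<subseteq> dyad m j"
proof -
  obtain p where p: "m' = m + p" using assms(1) le_Suc_ex by blast
  have "j' div 2 ^ p = j"
    using dyad_ancestor[of x m p j'] assms p by (simp add: mem_dyad_iff)
  then show ?thesis using dyad_ancestor p by blast
qed

lemma dyad_subdivide: "dyad m j = (\<Union>i\<in>{j * 2 ^ p..<(j + 1) * 2 ^ p}. dyad (m + p) i)"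
proof -
  have "i div 2 ^ p = j \<longleftrightarrow> i \<in> {j * 2 ^ p..<(j + 1) * 2 ^ p}" for i :: int
    using div_pos_geq[of "2^p" i] 
    by (auto simp: int_div_pos_eq algebra_simps
        intro!: int_div_pos_eq[of _ _ _ "i - j * 2 ^ p"])
       (smt (verit) div_mult_mod_eq mult.commute pos_mod_bound pos_mod_sign zero_less_power)+
  moreover have "x \<in> dyad m (\<lfloor>x * 2 ^ (m + p)\<rfloor> div 2 ^ p)" for x
    using dyad_ancestor[of x m p "\<lfloor>x * 2 ^ (m + p)\<rfloor>"] by (simp add: mem_dyad_iff)
  ultimately show ?thesis by (auto simp: mem_dyad_iff)
qed

lemma dyad_small_in_open:
  assumes "open U" "x \<in> U"
  obtains n where "\<And>m j. m \<ge> n \<Longrightarrow> x \<in> dyad m j \<Longrightarrow> dyad m j \<subseteq> U"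
proof -
  obtain e where e: "e > 0" "ball x e \<subseteq> U" using assms openE by blast
  obtain n where n: "(1/2 :: real) ^ n < e" using real_arch_pow_inv[of e "1/2"] e by auto
  have "dyad m j \<subseteq> U" if "m \<ge> n" "x \<in> dyad m j" for m j
  proof
    fix y assume "y \<in> dyad m j"
    then have "\<bar>x - y\<bar> < (1/2) ^ m"
      using that(2) by (auto simp: dyad_def add_divide_distrib power_one_over abs_if)
    also have "\<dots> \<le> (1/2) ^ n" using that(1) by (intro power_decreasing) auto
    finally show "y \<in> U" using n e(2) by (auto simp: dist_real_def)
  qed
  then show ?thesis using that by blast
qed

section \<open>Density along dyadic intervals\<close>

text \<open>The level \<open>n\<close> from which the estimate holds is a parameter because the two-dimensional argument
needs sets of points for which this level is the same.\<close>

definition dyadic_dense :: "real \<Rightarrow> nat \<Rightarrow> real set \<Rightarrow> real \<Rightarrow> bool" where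
  "dyadic_dense \<eta> n B x \<longleftrightarrow>
     (\<forall>m\<ge>n. \<forall>j. x \<in> dyad m j \<longrightarrow> emeasure lborel (dyad m j - B) \<le> ennreal (\<eta> / 2 ^ m))"

text \<open>The dyadic substitute for a covering theorem: dyadic intervals are pairwise nested or
disjoint, and here of length at most 1, so the union of any family is the disjoint union of its maximal members, and an estimate that holds on each
member can be summed.\<close>

lemma emeasure_union_dyads_diff_ge:
  assumes B: "B \<in> sets borel" and "0 \<le> \<eta>"
    and bad: "\<And>m j. (m, j) \<in> C \<Longrightarrow> ennreal (\<eta> / 2 ^ m) \<le> emeasure lborel (dyad m j - B)"
  shows "ennreal \<eta> * emeasure lborel (\<Union>(m, j)\<in>C. dyad m j)
           \<le> emeasure lborel ((\<Union>(m, j)\<in>C. dyad m j) - B)"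
proof -
  let ?D = "\<lambda>(m, j). dyad m j"
  \<comment> \<open>the maximal members of the family\<close>
  define F where "F = {(m, j) \<in> C. \<forall>(m', j') \<in> C. m' < m \<longrightarrow> dyad m j \<inter> dyad m' j' = {}}"
  have "F \<subseteq> C" by (auto simp: F_def)
  have eq: "c = d" if "c \<in> F" "d \<in> F" "x \<in> ?D c" "x \<in> ?D d" for c d x
  proof -
    obtain m j m' j' where eqs: "c = (m, j)" "d = (m', j')" by force
    with that have "\<not> m < m'" "\<not> m' < m" by (auto simp: F_def)
    with that eqs show ?thesis by (auto simp: mem_dyad_iff)
  qed
  have disj: "disjoint_family_on ?D F" "disjoint_family_on (\<lambda>c. ?D c - B) F"
    unfolding disjoint_family_on_def using eq by blast+
  have cover: "(\<Union>c\<in>C. ?D c) = (\<Union>c\<in>F. ?D c)"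
  proof
    show "(\<Union>c\<in>F. ?D c) \<subseteq> (\<Union>c\<in>C. ?D c)" using \<open>F \<subseteq> C\<close> by auto
    show "(\<Union>c\<in>C. ?D c) \<subseteq> (\<Union>c\<in>F. ?D c)"
    proof
      fix x assume "x \<in> (\<Union>c\<in>C. ?D c)"
      then have ex: "\<exists>m. \<exists>j. (m, j) \<in> C \<and> x \<in> dyad m j" by auto
      \<comment> \<open>the coarsest member containing \<open>x\<close> is maximal\<close>
      define m where "m = (LEAST m. \<exists>j. (m, j) \<in> C \<and> x \<in> dyad m j)"
      obtain j where j: "(m, j) \<in> C" "x \<in> dyad m j"
        using LeastI_ex[OF ex] m_def by blast
      have least: "\<not> ((m', j') \<in> C \<and> x \<in> dyad m' j')" if "m' < m" for m' j'
        using not_less_Least[OF that[unfolded m_def]] by blast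
      have "dyad m j \<inter> dyad m' j' = {}" if "(m', j') \<in> C" "m' < m" for m' j'
        using dyad_nested[of m' m _ j' j] least[OF that(2), of j'] that j(2) by auto
      then have "(m, j) \<in> F" using j(1) by (auto simp: F_def)
      then show "x \<in> (\<Union>c\<in>F. ?D c)" using j(2) by auto
    qed
  qed
  have [simp]: "countable F" by simp
  have "ennreal \<eta> * emeasure lborel (\<Union>c\<in>F. ?D c)
      = (\<integral>\<^sup>+c. ennreal \<eta> * emeasure lborel (?D c) \<partial>count_space F)"
    using disj(1) by (subst emeasure_UN_countable) (auto simp: nn_integral_cmult)
  also have "\<dots> \<le> (\<integral>\<^sup>+c. emeasure lborel (?D c - B) \<partial>count_space F)"
  proof (rule nn_integral_mono, goal_cases)
    case (1 c)
    obtain m j where c: "c = (m, j)" by force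
    have "ennreal \<eta> * emeasure lborel (dyad m j) = ennreal (\<eta> / 2 ^ m)"
      using \<open>0 \<le> \<eta>\<close> by (simp add: emeasure_dyad ennreal_mult [symmetric])
    then show ?case using bad[of m j] 1 \<open>F \<subseteq> C\<close> c by auto
  qed
  also have "\<dots> = emeasure lborel (\<Union>c\<in>F. ?D c - B)"
    using disj(2) B by (subst emeasure_UN_countable) auto
  also have "(\<Union>c\<in>F. ?D c - B) = (\<Union>c\<in>F. ?D c) - B" by auto
  finally show ?thesis by (simp only: cover)
qed

lemma borel_dyadic_dense:
  assumes "B \<in> sets borel"
  shows "{x. dyadic_dense \<eta> n B x} \<in> sets borel"
proof -
  have "{x. dyadic_dense \<eta> n B x} =
      - (\<Union>(m, j)\<in>{(m, j). n \<le> m \<and> ennreal (\<eta> / 2 ^ m) < emeasure lborel (dyad m j - B)}. dyad m j)"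
    by (auto simp: dyadic_dense_def not_less [symmetric])
  also have "\<dots> \<in> sets borel"
    by (intro borel_comp sets.countable_UN') auto
  finally show ?thesis .
qed

text \<open>Lebesgue's density theorem along dyadic intervals. The exceptional set \<open>N\<close> lies in an open set
\<open>U\<close> with \<open>U - N\<close> of measure less than \<open>e\<close>. Each point of \<open>N\<close> lies in a dyadic interval inside \<open>U\<close>
of which \<open>B\<close> misses a proportion of at least \<open>\<eta>\<close>, so \<open>B\<close> misses that proportion of the union \<open>S\<close> of
these intervals. But \<open>N \<subseteq> B\<close>, so what \<open>B\<close> misses of \<open>S\<close> lies in \<open>U - N\<close>; hence \<open>\<eta>\<close> times the measure of \<open>S\<close>,
and a fortiori of \<open>N\<close>, is at most \<open>e\<close>.\<close>

lemma AE_dyadic_dense: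
  assumes B: "B \<in> sets borel" and "\<eta> > 0"
  shows "AE x in lborel. x \<in> B \<longrightarrow> (\<exists>n. dyadic_dense \<eta> n B x)"
proof -
  define N where "N = B - (\<Union>n. {x. dyadic_dense \<eta> n B x})"
  have N: "N \<in> sets borel"
    unfolding N_def using borel_dyadic_dense[OF B] B by (intro sets.Diff sets.countable_UN) auto
  have small: "ennreal \<eta> * emeasure lborel N \<le> ennreal e" if "e > 0" for e
  proof -
    obtain U where U: "open U" "N \<subseteq> U" "emeasure lborel (U - N) < ennreal e"
      using outer_regular_lborel[OF N \<open>e > 0\<close>] .
    define C where "C = {(m, j). dyad m j \<subseteq> U \<and> ennreal (\<eta> / 2 ^ m) < emeasure lborel (dyad m j - B)}"
    let ?S = "\<Union>(m, j)\<in>C. dyad m j"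
    have S: "?S \<in> sets borel" by (intro sets.countable_UN') auto
    have "N \<subseteq> ?S"
    proof
      fix x assume x: "x \<in> N"
      then obtain n where n: "\<And>m j. m \<ge> n \<Longrightarrow> x \<in> dyad m j \<Longrightarrow> dyad m j \<subseteq> U"
        using dyad_small_in_open[OF U(1)] U(2) by blast
      have "\<not> dyadic_dense \<eta> n B x" using x by (auto simp: N_def)
      then obtain m j where mj: "m \<ge> n" "x \<in> dyad m j" "ennreal (\<eta> / 2 ^ m) < emeasure lborel (dyad m j - B)"
        unfolding dyadic_dense_def by (auto simp: not_le)
      with n have "(m, j) \<in> C" by (auto simp: C_def)
      with mj(2) show "x \<in> ?S" by blast
    qed
    then have "ennreal \<eta> * emeasure lborel N \<le> ennreal \<eta> * emeasure lborel ?S"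
      using S by (intro mult_left_mono emeasure_mono) auto
    also have "\<dots> \<le> emeasure lborel (?S - B)"
      using \<open>\<eta> > 0\<close> by (intro emeasure_union_dyads_diff_ge[OF B]) (auto simp: C_def intro: less_imp_le)
    also have "\<dots> \<le> emeasure lborel (U - N)"
      using U(1) N by (intro emeasure_mono) (auto simp: C_def N_def)
    also have "\<dots> \<le> ennreal e" using U(3) by simp
    finally show ?thesis .
  qed
  have "ennreal \<eta> * emeasure lborel N \<le> 0"
    by (rule ennreal_le_epsilon) (use small in simp)
  then have "emeasure lborel N = 0" using \<open>\<eta> > 0\<close> by simp
  then have "N \<in> null_sets lborel" using N by auto
  then have "AE x in lborel. x \<notin> N" by (rule AE_not_in)
  then show ?thesis by (rule AE_mp) (auto simp: N_def)
qed

section \<open>Strong density along dyadic rectangles\<close>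

lemma sets_lborel_pair: "sets (lborel \<Otimes>\<^sub>M lborel) = sets (borel :: (real \<times> real) measure)"
  by (simp only: lborel_prod sets_lborel)

lemma borel_section:
  fixes B :: "(real \<times> real) set"
  assumes "B \<in> sets borel"
  shows "Pair x -` B \<in> sets borel"
  using sets_Pair1[of B lborel lborel x] assms unfolding sets_lborel_pair by simp

lemma borel_measurable_swap: "prod.swap \<in> borel_measurable (borel :: (real \<times> real) measure)"
  by (intro borel_measurable_continuous_onI continuous_on_swap)

lemma borel_dyadic_dense_sections:
  fixes B :: "(real \<times> real) set"
  assumes B: "B \<in> sets borel"
  shows "{p. dyadic_dense \<eta> n (Pair (fst p) -` B) (snd p)} \<in> sets borel"
proof -
  define E where "E m j = {x. ennreal (\<eta> / 2 ^ m) < emeasure lborel (dyad m j - Pair x -` B)}" for m j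
  have "{p. dyadic_dense \<eta> n (Pair (fst p) -` B) (snd p)} = - (\<Union>(m, j)\<in>{n..} \<times> UNIV. E m j \<times> dyad m j)"
    by (auto simp: dyadic_dense_def E_def not_less [symmetric])
  also have "\<dots> \<in> sets borel"
  proof (intro borel_comp sets.countable_UN', safe)
    fix m j
    have Q: "UNIV \<times> dyad m j - B \<in> sets (lborel \<Otimes>\<^sub>M lborel)"
      unfolding sets_lborel_pair using B by (auto intro!: sets.Diff borel_Times)
    have "(\<lambda>x. emeasure lborel (dyad m j - Pair x -` B)) \<in> borel_measurable borel"
      using lborel.measurable_emeasure_Pair[OF Q] by (simp add: vimage_Diff Times_Int_distrib1 vimage_def Diff_eq Int_def Compl_eq)
    then have "E m j \<in> sets borel"
      unfolding E_def by measurable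
    then show "E m j \<times> dyad m j \<in> sets borel"
      by (intro borel_Times) auto
  qed auto
  finally show ?thesis .
qed

lemma AE_dyadic_dense_sections:
  fixes B :: "(real \<times> real) set"
  assumes B: "B \<in> sets borel" and "\<eta> > 0"
  shows "AE p in lborel. p \<in> B \<longrightarrow> (\<exists>n. dyadic_dense \<eta> n (Pair (fst p) -` B) (snd p))"
proof -
  have meas: "{p. p \<in> B \<longrightarrow> (\<exists>n. dyadic_dense \<eta> n (Pair (fst p) -` B) (snd p))} \<in> sets borel"
  proof -
    have "{p. p \<in> B \<longrightarrow> (\<exists>n. dyadic_dense \<eta> n (Pair (fst p) -` B) (snd p))}
       = - B \<union> (\<Union>n. {p. dyadic_dense \<eta> n (Pair (fst p) -` B) (snd p)})"
      by auto
    also have "\<dots> \<in> sets borel"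
      using borel_dyadic_dense_sections[OF B] B by (intro sets.Un borel_comp sets.countable_UN) auto
    finally show ?thesis .
  qed
  have "AE x in lborel. AE y in lborel. (x, y) \<in> B \<longrightarrow> (\<exists>n. dyadic_dense \<eta> n (Pair x -` B) y)"
  proof (rule AE_I2)
    fix x :: real
    have "Pair x -` B \<in> sets borel"
      using borel_section[OF B] .
    from AE_dyadic_dense[OF this \<open>\<eta> > 0\<close>]
    show "AE y in lborel. (x, y) \<in> B \<longrightarrow> (\<exists>n. dyadic_dense \<eta> n (Pair x -` B) y)" by simp
  qed
  moreover have "{p \<in> space (lborel \<Otimes>\<^sub>M lborel). (fst p, snd p) \<in> B \<longrightarrow>
      (\<exists>n. dyadic_dense \<eta> n (Pair (fst p) -` B) (snd p))} \<in> sets (lborel \<Otimes>\<^sub>M lborel)"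
    unfolding sets_lborel_pair using meas by (simp add: space_pair_measure)
  ultimately have "AE p in lborel \<Otimes>\<^sub>M lborel. (fst p, snd p) \<in> B \<longrightarrow>
      (\<exists>n. dyadic_dense \<eta> n (Pair (fst p) -` B) (snd p))"
    by (subst (asm) lborel_pair.AE_pair_iff
        [where P = "\<lambda>x y. (x, y) \<in> B \<longrightarrow> (\<exists>n. dyadic_dense \<eta> n (Pair x -` B) y)"])
  then show ?thesis by (simp only: lborel_prod prod.collapse)
qed

lemma AE_lborel_swap:
  fixes P :: "real \<times> real \<Rightarrow> bool"
  assumes "AE p in lborel. P p"
  shows "AE p in lborel. P (prod.swap p)"
proof -
  have "(\<lambda>(x, y). (y, x)) = (prod.swap :: real \<times> real \<Rightarrow> _)" by auto
  then have "lborel = distr lborel lborel (prod.swap :: real \<times> real \<Rightarrow> _)"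
    using lborel_pair.distr_pair_swap [where ?'a = real and ?'b = real] by (simp only: lborel_prod)
  moreover have "prod.swap \<in> (lborel :: (real \<times> real) measure) \<rightarrow>\<^sub>M lborel"
    using borel_measurable_swap by simp
  ultimately show ?thesis
    using assms AE_distrD[of prod.swap lborel lborel P] by metis
qed

text \<open>One point that is dense in the vertical direction controls a whole rectangle. All but a proportion
\<open>\<eta>\<close> of the horizontal slices of the rectangle meet the vertical line through \<open>(x, y)\<close> in a point of \<open>H\<close>,
and \<open>B\<close> misses at most a proportion \<open>\<eta>\<close> of each of those. The remaining slices are counted in full.\<close>

lemma emeasure_dyad_rectangle_diff_le:
  fixes B :: "(real \<times> real) set"
  assumes B: "B \<in> sets borel" and H: "H \<in> sets borel" and "0 \<le> \<eta>"
    and HB: "\<And>p. p \<in> H \<Longrightarrow> dyadic_dense \<eta> n ((\<lambda>u. (u, snd p)) -` B) (fst p)"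
    and dense: "dyadic_dense \<eta> l (Pair x -` H) y"
    and "n \<le> m" "l \<le> k" and x: "x \<in> dyad m i" and y: "y \<in> dyad k j"
  shows "emeasure lborel (dyad m i \<times> dyad k j - B) \<le> ennreal (2 * \<eta> / 2 ^ m / 2 ^ k)"
proof -
  let ?R = "dyad m i \<times> dyad k j"
  have R: "?R - B \<in> sets (lborel \<Otimes>\<^sub>M lborel)"
    unfolding sets_lborel_pair using B by (auto intro!: sets.Diff borel_Times)
  have Hx: "Pair x -` H \<in> sets borel"
    using borel_section[OF H] .
  have slice: "emeasure lborel ((\<lambda>u. (u, v)) -` (?R - B))
      \<le> ennreal (\<eta> / 2 ^ m) * indicator (dyad k j) v
        + ennreal (1 / 2 ^ m) * indicator (dyad k j - Pair x -` H) v" for v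
  proof -
    have eq: "(\<lambda>u. (u, v)) -` (?R - B) = (if v \<in> dyad k j then dyad m i - (\<lambda>u. (u, v)) -` B else {})"
      by auto
    show ?thesis
    proof (cases "v \<in> dyad k j \<and> (x, v) \<in> H")
      case True
      then have "dyadic_dense \<eta> n ((\<lambda>u. (u, v)) -` B) x" using HB[of "(x, v)"] by simp
      then show ?thesis using True eq x \<open>n \<le> m\<close> by (simp add: dyadic_dense_def)
    next
      case False
      have "emeasure lborel (dyad m i - (\<lambda>u. (u, v)) -` B) \<le> emeasure lborel (dyad m i)"
        by (intro emeasure_mono) auto
      also have "\<dots> = ennreal (1 / 2 ^ m)" by (rule emeasure_dyad)
      finally show ?thesis using False eq by (auto simp: add_increasing)
    qed
  qed
  have "emeasure lborel (?R - B) = (\<integral>\<^sup>+v. emeasure lborel ((\<lambda>u. (u, v)) -` (?R - B)) \<partial>lborel)"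
    using lborel_pair.emeasure_pair_measure_alt2[OF R] by (simp add: lborel_prod)
  also have "\<dots> \<le> (\<integral>\<^sup>+v. ennreal (\<eta> / 2 ^ m) * indicator (dyad k j) v
        + ennreal (1 / 2 ^ m) * indicator (dyad k j - Pair x -` H) v \<partial>lborel)"
    using slice by (intro nn_integral_mono)
  also have "\<dots> = ennreal (\<eta> / 2 ^ m) * emeasure lborel (dyad k j)
      + ennreal (1 / 2 ^ m) * emeasure lborel (dyad k j - Pair x -` H)"
    using Hx by (simp add: nn_integral_add nn_integral_cmult_indicator)
  also have "\<dots> \<le> ennreal (\<eta> / 2 ^ m) * ennreal (1 / 2 ^ k)
      + ennreal (1 / 2 ^ m) * ennreal (\<eta> / 2 ^ k)"
    using dense y \<open>l \<le> k\<close> by (intro add_mono mult_left_mono) (auto simp: emeasure_dyad dyadic_dense_def)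
  also have "\<dots> = ennreal (2 * \<eta> / 2 ^ m / 2 ^ k)"
    using \<open>0 \<le> \<eta>\<close> by (simp add: ennreal_mult [symmetric] ennreal_plus [symmetric] del: ennreal_plus)
  finally show ?thesis .
qed

text \<open>The strong density theorem. Almost every point of \<open>B\<close> is horizontally dense from some level \<open>n\<close> on,
that is, lies in some \<open>H n\<close>; and almost every point of \<open>H n\<close> is a vertically dense point of \<open>H n\<close>, not
merely of \<open>B\<close>. The rectangle estimate then applies to all rectangles containing the point, however
eccentric, because the levels from which the two densities hold are chosen independently of the
rectangle.\<close>

lemma AE_strong_dyadic_density:
  fixes B :: "(real \<times> real) set"
  assumes B: "B \<in> sets borel" and "\<eta> > 0"
  shows "AE p in lborel. p \<in> B \<longrightarrow> (\<exists>N. \<forall>m\<ge>N. \<forall>k\<ge>N. \<forall>i j. p \<in> dyad m i \<times> dyad k j \<longrightarrow>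
           emeasure lborel (dyad m i \<times> dyad k j - B) \<le> ennreal (\<eta> / 2 ^ m / 2 ^ k))"
proof -
  define H where "H n = {p \<in> B. dyadic_dense (\<eta>/2) n ((\<lambda>u. (u, snd p)) -` B) (fst p)}" for n
  \<comment> \<open>the theorem for vertical sections, applied to the reflected set, covers horizontal sections\<close>
  let ?B' = "prod.swap -` B"
  have B': "?B' \<in> sets borel"
    using measurable_sets[OF borel_measurable_swap B] by simp
  have sec: "Pair v -` ?B' = (\<lambda>u. (u, v)) -` B" for v by auto
  have H: "H n \<in> sets borel" for n
  proof -
    have "H n = B \<inter> prod.swap -` {p. dyadic_dense (\<eta>/2) n (Pair (fst p) -` ?B') (snd p)}"
      unfolding sec by (auto simp: H_def)
    then show ?thesis
      using measurable_sets[OF borel_measurable_swap borel_dyadic_dense_sections[OF B', of "\<eta>/2" n]] B by simp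
  qed
  have 1: "AE p in lborel. p \<in> B \<longrightarrow> (\<exists>n. p \<in> H n)"
  proof -
    have "AE p in lborel. prod.swap p \<in> ?B' \<longrightarrow>
        (\<exists>n. dyadic_dense (\<eta>/2) n (Pair (fst (prod.swap p)) -` ?B') (snd (prod.swap p)))"
      using \<open>\<eta> > 0\<close> by (intro AE_lborel_swap AE_dyadic_dense_sections[OF B']) simp
    then show ?thesis unfolding sec by (simp add: H_def)
  qed
  have 2: "AE p in lborel. \<forall>n. p \<in> H n \<longrightarrow> (\<exists>l. dyadic_dense (\<eta>/2) l (Pair (fst p) -` H n) (snd p))"
    using \<open>\<eta> > 0\<close> by (intro AE_all_countable[THEN iffD2] allI AE_dyadic_dense_sections[OF H]) simp
  show ?thesis
    using 1 2
  proof eventually_elim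
    case (elim p)
    show ?case
    proof
      assume "p \<in> B"
      then obtain n where n: "p \<in> H n" using elim(1) by blast
      then obtain l where l: "dyadic_dense (\<eta>/2) l (Pair (fst p) -` H n) (snd p)" using elim(2) by blast
      have "emeasure lborel (dyad m i \<times> dyad k j - B) \<le> ennreal (2 * (\<eta>/2) / 2 ^ m / 2 ^ k)"
        if "max n l \<le> m" "max n l \<le> k" "p \<in> dyad m i \<times> dyad k j" for m k i j
        using \<open>\<eta> > 0\<close> that l by (intro emeasure_dyad_rectangle_diff_le[OF B H[of n], of "\<eta>/2" n l "fst p" "snd p"])
          (auto simp: H_def)
      then show "\<exists>N. \<forall>m\<ge>N. \<forall>k\<ge>N. \<forall>i j. p \<in> dyad m i \<times> dyad k j \<longrightarrow>
           emeasure lborel (dyad m i \<times> dyad k j - B) \<le> ennreal (\<eta> / 2 ^ m / 2 ^ k)"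
        by (intro exI[of _ "max n l"]) simp
    qed
  qed
qed

lemma AE_strong_dyadic_density_lebesgue:
  fixes A :: "(real \<times> real) set"
  assumes A: "A \<in> sets lebesgue" and "\<eta> > 0"
  shows "AE x in lebesgue. x \<in> A \<longrightarrow> (\<exists>N. \<forall>m\<ge>N. \<forall>k\<ge>N. \<forall>i j. x \<in> dyad m i \<times> dyad k j \<longrightarrow>
           emeasure lebesgue (dyad m i \<times> dyad k j - A) \<le> ennreal (\<eta> / 2 ^ m / 2 ^ k))"
proof -
  obtain B Z Z' where BZ: "A = B \<union> Z" "Z \<subseteq> Z'" "Z' \<in> null_sets lborel" "B \<in> sets lborel"
    using A by (rule sets_completionE)
  have B: "B \<in> sets borel" using BZ(4) by simp
  have *: "emeasure lebesgue (dyad m i \<times> dyad k j - A) \<le> emeasure lborel (dyad m i \<times> dyad k j - B)" for m i k j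
  proof -
    have R: "dyad m i \<times> dyad k j - B \<in> sets lborel"
      using B by (auto intro!: sets.Diff borel_Times)
    have "emeasure lebesgue (dyad m i \<times> dyad k j - A) \<le> emeasure lebesgue (dyad m i \<times> dyad k j - B)"
      using R BZ(1) by (intro emeasure_mono) auto
    then show ?thesis using R by simp
  qed
  have "AE x in lebesgue. x \<notin> Z'"
    using AE_completion[OF AE_not_in[OF BZ(3)]] .
  with AE_completion[OF AE_strong_dyadic_density[OF B \<open>\<eta> > 0\<close>]]
  show ?thesis
  proof eventually_elim
    case (elim x)
    then show ?case using BZ(1,2) order_trans[OF *] by blast
  qed
qed

section \<open>Averages over dyadic rectangles\<close>

lemma dyad_rectangle_sets [measurable]: "dyad m i \<times> dyad k j \<in> sets borel"
  by (intro borel_Times) auto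

lemma emeasure_dyad_rectangle: "emeasure lebesgue (dyad m i \<times> dyad k j) = ennreal (1 / 2 ^ m / 2 ^ k)"
proof -
  have "emeasure lebesgue (dyad m i \<times> dyad k j) = emeasure lborel (dyad m i \<times> dyad k j)"
    using dyad_rectangle_sets by simp
  also have "\<dots> = emeasure lborel (dyad m i) * emeasure lborel (dyad k j)"
    by (subst lborel_prod [symmetric], subst lborel.emeasure_pair_measure_Times) auto
  also have "\<dots> = ennreal (1 / 2 ^ m / 2 ^ k)"
    by (simp add: emeasure_dyad ennreal_mult [symmetric])
  finally show ?thesis .
qed

lemma measure_dyad_rectangle: "measure lebesgue (dyad m i \<times> dyad k j) = 1 / 2 ^ m / 2 ^ k"
  by (simp only: measure_def emeasure_dyad_rectangle enn2real_ennreal) simp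

definition average :: "('a::euclidean_space \<Rightarrow> real) \<Rightarrow> 'a set \<Rightarrow> real" where
  "average f E = 1 / measure lebesgue E * (LINT t:E|lebesgue. f t)"

text \<open>The average over a disjoint union is a convex combination of the averages over the parts.\<close>

lemma average_disjoint_Union_near:
  assumes "finite I" and disj: "disjoint_family_on X I" and "I \<noteq> {}"
    and X: "\<And>i. i \<in> I \<Longrightarrow> X i \<in> lmeasurable" and pos: "\<And>i. i \<in> I \<Longrightarrow> measure lebesgue (X i) > 0"
    and f: "set_integrable lebesgue (\<Union>i\<in>I. X i) f"
    and near: "\<And>i. i \<in> I \<Longrightarrow> \<bar>average f (X i) - c\<bar> \<le> e"
  shows "\<bar>average f (\<Union>i\<in>I. X i) - c\<bar> \<le> e"
proof -
  let ?\<mu> = "measure lebesgue"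
  have \<mu>: "?\<mu> (\<Union>i\<in>I. X i) = (\<Sum>i\<in>I. ?\<mu> (X i))"
  proof (rule measure_finite_Union[OF \<open>finite I\<close> _ disj])
    show "X ` I \<subseteq> sets lebesgue" using X by (auto dest: fmeasurableD)
    show "emeasure lebesgue (X i) \<noteq> \<infinity>" if "i \<in> I" for i
      using fmeasurableD2[OF X[OF that]] by simp
  qed
  then have \<mu>pos: "?\<mu> (\<Union>i\<in>I. X i) > 0"
    using pos \<open>I \<noteq> {}\<close> \<open>finite I\<close> by (simp add: sum_pos)
  have int: "(LINT t:(\<Union>i\<in>I. X i)|lebesgue. f t) = (\<Sum>i\<in>I. LINT t:X i|lebesgue. f t)"
    using X f \<open>finite I\<close> disj
    by (intro set_integral_finite_Union) (auto intro: set_integrable_subset simp: fmeasurable_def)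
  have piece: "\<bar>(LINT t:X i|lebesgue. f t) - c * ?\<mu> (X i)\<bar> \<le> e * ?\<mu> (X i)" if "i \<in> I" for i
  proof -
    have "(LINT t:X i|lebesgue. f t) - c * ?\<mu> (X i) = (average f (X i) - c) * ?\<mu> (X i)"
      using pos[OF that] by (simp add: average_def field_simps)
    then show ?thesis
      using near[OF that] pos[OF that] by (simp add: abs_mult)
  qed
  have "(average f (\<Union>i\<in>I. X i) - c) * ?\<mu> (\<Union>i\<in>I. X i)
      = (\<Sum>i\<in>I. (LINT t:X i|lebesgue. f t) - c * ?\<mu> (X i))"
  proof -
    have "(average f (\<Union>i\<in>I. X i) - c) * ?\<mu> (\<Union>i\<in>I. X i)
        = (LINT t:(\<Union>i\<in>I. X i)|lebesgue. f t) - c * ?\<mu> (\<Union>i\<in>I. X i)"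
      using \<mu>pos by (simp add: average_def field_simps)
    then show ?thesis by (simp only: int \<mu> sum_subtractf sum_distrib_left)
  qed
  then have "\<bar>average f (\<Union>i\<in>I. X i) - c\<bar> * ?\<mu> (\<Union>i\<in>I. X i)
      = \<bar>\<Sum>i\<in>I. (LINT t:X i|lebesgue. f t) - c * ?\<mu> (X i)\<bar>"
    using \<mu>pos by (metis abs_mult abs_of_pos)
  also have "\<dots> \<le> (\<Sum>i\<in>I. e * ?\<mu> (X i))"
    using piece by (intro order_trans[OF sum_abs] sum_mono)
  also have "\<dots> = e * ?\<mu> (\<Union>i\<in>I. X i)" by (simp add: \<mu> sum_distrib_left)
  finally show ?thesis using \<mu>pos by simp
qed

lemma set_integrable_bounded:
  assumes "locally_integrable f" "bounded E" "E \<in> sets lebesgue"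
  shows "set_integrable lebesgue E f"
proof (rule set_integrable_subset)
  show "set_integrable lebesgue (closure E) f"
    using assms by (simp add: locally_integrable_def compact_closure)
qed (use assms closure_subset in auto)

lemma locally_integrable_measurable:
  fixes f :: "'a::euclidean_space \<Rightarrow> real"
  assumes "locally_integrable f"
  shows "f \<in> borel_measurable lebesgue"
proof (rule borel_measurable_LIMSEQ_real)
  fix x :: 'a
  obtain n :: nat where "norm x \<le> real n" using real_arch_simple by blast
  then have "\<forall>\<^sub>F i in sequentially. indicator (cball 0 (real i)) x *\<^sub>R f x = f x"
    by (intro eventually_sequentiallyI[of n]) auto
  then show "(\<lambda>i. indicator (cball 0 (real i)) x *\<^sub>R f x) \<longlonglongrightarrow> f x"
    by (rule tendsto_eventually)
next
  fix i :: nat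
  show "(\<lambda>x. indicator (cball 0 (real i)) x *\<^sub>R f x) \<in> borel_measurable lebesgue"
    using assms compact_cball unfolding locally_integrable_def set_integrable_def
    by (blast intro: borel_measurable_integrable)
qed

lemma bounded_dyad: "bounded (dyad m j)"
  by (simp add: dyad_def)

lemma diameter_dyad_rectangle_le: "diameter (dyad m i \<times> dyad k j) \<le> (1/2) ^ m + (1/2) ^ k"
proof (rule diameter_le)
  fix y z assume "y \<in> dyad m i \<times> dyad k j" "z \<in> dyad m i \<times> dyad k j"
  then have "\<bar>fst y - fst z\<bar> \<le> (1/2) ^ m" "\<bar>snd y - snd z\<bar> \<le> (1/2) ^ k"
    by (auto simp: dyad_def add_divide_distrib power_one_over)
  then show "norm (y - z) \<le> (1/2) ^ m + (1/2) ^ k"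
    using norm_Pair_le[of "fst y - fst z" "snd y - snd z"] by (simp add: minus_prod_def)
qed auto

lemma dyad_rectangle_mem:
  assumes "int m \<in> \<Delta>" "int k \<in> \<Delta>"
  shows "dyad m i \<times> dyad k j \<in> dyadic_rectangles \<Delta>"
proof -
  have "dyad m i \<times> dyad k j =
     {(of_int (i+1) - 1) / 2 powi (int m) ..< of_int (i+1) / 2 powi (int m)} \<times>
      {(of_int (j+1) - 1) / 2 powi (int k) ..< of_int (j+1) / 2 powi (int k)}"
    by (simp add: dyad_def)
  then show ?thesis using assms unfolding dyadic_rectangles_def by blast
qed

lemma level_gt_of_length_lt:
  assumes "1 / 2 powi a < (1/2 :: real) ^ N"
  shows "a > int N"
proof (rule ccontr)
  assume "\<not> ?thesis"
  then have "(2::real) powi a \<le> 2 powi (int N)" by (intro power_int_increasing) auto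
  moreover have "(2::real) powi a > 0" by simp
  ultimately have "(1/2 :: real) ^ N \<le> 1 / 2 powi a"
    by (simp add: power_one_over divide_simps)
  with assms show False by simp
qed

text \<open>A rectangle of small diameter has both sides short, so both of its levels are large, and in
particular they are natural numbers.\<close>

lemma small_dyadic_rectangle:
  assumes E: "E \<in> dyadic_rectangles \<Delta>" and "x \<in> E" and small: "diameter E < (1/2) ^ Suc N"
  obtains m k i j where "m \<ge> N" "k \<ge> N" "int m \<in> \<Delta>" "int k \<in> \<Delta>" "E = dyad m i \<times> dyad k j"
proof -
  obtain j1 j2 m1 m2 where D: "m1 \<in> \<Delta>" "m2 \<in> \<Delta>" and
    eq: "E = {(of_int j1 - 1) / 2 powi m1 ..< of_int j1 / 2 powi m1} \<times>
      {(of_int j2 - 1) / 2 powi m2 ..< of_int j2 / 2 powi m2}"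
    using E unfolding dyadic_rectangles_def by blast
  define r s :: real where "r = 1 / 2 powi m1" and "s = 1 / 2 powi m2"
  define a b :: real where "a = (of_int j1 - 1) / 2 powi m1" and "b = (of_int j2 - 1) / 2 powi m2"
  have rs: "r > 0" "s > 0" by (simp_all add: r_def s_def)
  have E': "E = {a ..< a + r} \<times> {b ..< b + s}"
    by (simp add: eq a_def b_def r_def s_def add_divide_distrib [symmetric])
  have bdd: "bounded E" unfolding E' by (intro bounded_Times) auto
  have "dist (a, b) (a + r / 2, b) \<le> diameter E"
    by (rule diameter_bounded_bound[OF bdd]) (use rs in \<open>auto simp: E'\<close>)
  then have "r < (1/2) ^ N" using small rs by (simp add: dist_Pair_Pair dist_real_def)
  moreover have "dist (a, b) (a, b + s / 2) \<le> diameter E"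
    by (rule diameter_bounded_bound[OF bdd]) (use rs in \<open>auto simp: E'\<close>)
  then have "s < (1/2) ^ N" using small rs by (simp add: dist_Pair_Pair dist_real_def)
  ultimately have m: "m1 > int N" "m2 > int N"
    using level_gt_of_length_lt by (simp_all add: r_def s_def)
  then have "E = dyad (nat m1) (j1 - 1) \<times> dyad (nat m2) (j2 - 1)"
    by (simp add: eq dyad_def power_int_def)
  then show ?thesis using m D that[of "nat m1" "nat m2" "j1 - 1" "j2 - 1"] by simp
qed

text \<open>Diameter tending to 0 means that both levels tend to infinity, independently of each other. This
replaces the filter by explicit quantifiers over levels and positions.\<close>

lemma eventually_shrinking_to_dyadic:
  "eventually P (shrinking_to (dyadic_rectangles \<Delta>) x) \<longleftrightarrow>
     (\<exists>N. \<forall>m\<ge>N. \<forall>k\<ge>N. int m \<in> \<Delta> \<longrightarrow> int k \<in> \<Delta> \<longrightarrow>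
        (\<forall>i j. x \<in> dyad m i \<times> dyad k j \<longrightarrow> P (dyad m i \<times> dyad k j)))" (is "?L \<longleftrightarrow> ?R")
proof
  assume ?L
  then obtain d where "d > 0" and
    d: "\<And>E. E \<in> dyadic_rectangles \<Delta> \<Longrightarrow> x \<in> E \<Longrightarrow> \<bar>diameter E\<bar> < d \<Longrightarrow> P E"
    unfolding eventually_shrinking_to by blast
  obtain N where N: "(1/2 :: real) ^ N < d / 2"
    using real_arch_pow_inv[of "d/2" "1/2"] \<open>d > 0\<close> by auto
  have "\<bar>diameter (dyad m i \<times> dyad k j)\<bar> < d" if "m \<ge> N" "k \<ge> N" for m k i j
  proof -
    have "(1/2 :: real) ^ m \<le> (1/2) ^ N" "(1/2 :: real) ^ k \<le> (1/2) ^ N"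
      using that by (auto intro!: power_decreasing)
    then show ?thesis
      using N diameter_dyad_rectangle_le[of m i k j]
        diameter_ge_0[of "dyad m i \<times> dyad k j"] bounded_Times[OF bounded_dyad bounded_dyad, of m i k j] by linarith
  qed
  then show ?R using d dyad_rectangle_mem by blast
next
  assume ?R
  then obtain N where N: "\<And>m k i j. m \<ge> N \<Longrightarrow> k \<ge> N \<Longrightarrow> int m \<in> \<Delta> \<Longrightarrow> int k \<in> \<Delta> \<Longrightarrow>
      x \<in> dyad m i \<times> dyad k j \<Longrightarrow> P (dyad m i \<times> dyad k j)" by blast
  show ?L
    unfolding eventually_shrinking_to
  proof (intro exI conjI ballI impI)
    show "(1/2 :: real) ^ Suc N > 0" by simp
    fix E assume E: "E \<in> dyadic_rectangles \<Delta>" "x \<in> E \<and> \<bar>diameter E\<bar> < (1/2) ^ Suc N"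
    then show "P E" using small_dyadic_rectangle[of E \<Delta> x N] N by (metis abs_less_iff)
  qed
qed

lemma osc_eq_0_iff:
  assumes "differentiation_basis B"
  shows "osc B x f = 0 \<longleftrightarrow>
    (\<forall>e>0. eventually (\<lambda>E. \<bar>average f E - f x\<bar> \<le> e) (shrinking_to B x))"
proof -
  let ?F = "shrinking_to B x" and ?g = "\<lambda>E. ereal \<bar>average f E - f x\<bar>"
  have osc: "osc B x f = Limsup ?F ?g" by (simp add: osc_def average_def)
  \<comment> \<open>the limit superior along a trivial filter would be \<open>-\<infinity>\<close>, not 0\<close>
  have "?F \<noteq> bot"
  proof
    assume "?F = bot"
    then have "eventually (\<lambda>_. False) ?F" by simp
    then obtain d where d: "d > 0" "\<And>E. E \<in> B \<Longrightarrow> x \<in> E \<Longrightarrow> \<not> \<bar>diameter E\<bar> < d"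
      unfolding eventually_shrinking_to by blast
    obtain E where E: "E \<in> B" "x \<in> E" "diameter E < d"
      using assms d(1) unfolding differentiation_basis_def by blast
    moreover have "bounded E" using assms E(1) by (auto simp: differentiation_basis_def)
    then have "diameter E \<ge> 0" by (rule diameter_ge_0)
    ultimately show False using d(2)[of E] by linarith
  qed
  then have ge: "0 \<le> osc B x f" unfolding osc by (intro le_Limsup) auto
  show ?thesis
  proof
    assume "osc B x f = 0"
    then have lt: "\<And>y. y > 0 \<Longrightarrow> eventually (\<lambda>E. ?g E < y) ?F"
      unfolding osc using Limsup_le_iff[of ?F ?g 0] by simp
    show "\<forall>e>0. eventually (\<lambda>E. \<bar>average f E - f x\<bar> \<le> e) ?F"
    proof (intro allI impI)
      fix e :: real assume "e > 0"
      then show "eventually (\<lambda>E. \<bar>average f E - f x\<bar> \<le> e) ?F"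
        using lt[of "ereal e"] by (auto elim: eventually_mono)
    qed
  next
    assume *: "\<forall>e>0. eventually (\<lambda>E. \<bar>average f E - f x\<bar> \<le> e) ?F"
    have "osc B x f \<le> 0"
    proof (rule ereal_le_epsilon2)
      fix e :: real assume "e > 0"
      then have "osc B x f \<le> ereal e" unfolding osc using * by (intro Limsup_bounded) simp
      then show "osc B x f \<le> 0 + ereal e" by simp
    qed
    with ge show "osc B x f = 0" by simp
  qed
qed

section \<open>Passing from a set of levels to all levels\<close>

definition averages_close :: "int set \<Rightarrow> (real \<times> real \<Rightarrow> real) \<Rightarrow> real \<Rightarrow> nat \<Rightarrow> real \<times> real \<Rightarrow> bool" where
  "averages_close \<Delta> f e N x \<longleftrightarrow> (\<forall>m\<ge>N. \<forall>k\<ge>N. int m \<in> \<Delta> \<longrightarrow> int k \<in> \<Delta> \<longrightarrow>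
     (\<forall>i j. x \<in> dyad m i \<times> dyad k j \<longrightarrow> \<bar>average f (dyad m i \<times> dyad k j) - f x\<bar> \<le> e))"

lemma osc_dyadic_eq_0_iff:
  assumes "\<And>n. \<exists>m\<in>\<Delta>. n \<le> m"
  shows "osc (dyadic_rectangles \<Delta>) x f = 0 \<longleftrightarrow> (\<forall>e>0. \<exists>N. averages_close \<Delta> f e N x)"
  unfolding osc_eq_0_iff[OF differentiation_basis_dyadic_rectangles[OF assms]]
    eventually_shrinking_to_dyadic averages_close_def ..

lemma sets_averages_close:
  assumes f: "f \<in> borel_measurable lebesgue"
  shows "{x. \<bar>f x - c\<bar> \<le> e \<and> averages_close \<Delta> f e N x} \<in> sets lebesgue"
proof -
  note [measurable] = f
  have R [measurable]: "dyad m i \<times> dyad k j \<in> sets lebesgue" for m i k j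
    using dyad_rectangle_sets by auto
  have "Measurable.pred lebesgue (\<lambda>x. \<bar>f x - c\<bar> \<le> e \<and> averages_close \<Delta> f e N x)"
    unfolding averages_close_def by measurable
  then show ?thesis by (simp add: pred_def)
qed

text \<open>This is where the finite refinement enters. The rectangle is a disjoint union of equal pieces with
levels in \<open>\<Delta>\<close>, and the part of it outside \<open>A\<close> has less measure than one piece, so every piece contains
a point \<open>z\<close> of \<open>A\<close>. The average over the piece is within \<open>e\<close> of \<open>f z\<close>, which is within \<open>e\<close> of \<open>c\<close>; thus
the average over the whole rectangle is within \<open>2 * e\<close> of \<open>c\<close> as well. The constant \<open>c\<close> is needed
because different pieces are met in different points.\<close>

lemma average_near_if_pieces_meet:
  fixes f :: "real \<times> real \<Rightarrow> real"
  assumes f: "locally_integrable f"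
    and A: "A \<in> sets lebesgue" "\<And>z. z \<in> A \<Longrightarrow> \<bar>f z - c\<bar> \<le> e \<and> averages_close \<Delta> f e N z"
    and mk: "m \<ge> N" "k \<ge> N" and \<Delta>: "int (m + p) \<in> \<Delta>" "int (k + q) \<in> \<Delta>"
    and thin: "emeasure lebesgue (dyad m i \<times> dyad k j - A) < ennreal (1 / 2 ^ (m + p) / 2 ^ (k + q))"
  shows "\<bar>average f (dyad m i \<times> dyad k j) - c\<bar> \<le> 2 * e"
proof -
  let ?I = "{i * 2 ^ p..<(i + 1) * 2 ^ p} \<times> {j * 2 ^ q..<(j + 1) * 2 ^ q}"
  let ?X = "\<lambda>(i', j'). dyad (m + p) i' \<times> dyad (k + q) j'"
  have R: "dyad m i \<times> dyad k j = (\<Union>a\<in>?I. ?X a)"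
    unfolding dyad_subdivide[of m i p] dyad_subdivide[of k j q] by auto
  have X: "?X a \<in> sets lebesgue" for a using dyad_rectangle_sets by (auto split: prod.splits)
  have \<mu>: "emeasure lebesgue (?X a) = ennreal (1 / 2 ^ (m + p) / 2 ^ (k + q))" for a
    by (simp only: case_prod_unfold emeasure_dyad_rectangle)
  have "\<bar>average f (\<Union>a\<in>?I. ?X a) - c\<bar> \<le> 2 * e"
  proof (rule average_disjoint_Union_near)
    show "disjoint_family_on ?X ?I" by (auto simp: disjoint_family_on_def mem_dyad_iff)
    show "?X a \<in> lmeasurable" for a using X \<mu> by (intro fmeasurableI) simp_all
    show "measure lebesgue (?X a) > 0" for a
      by (simp add: case_prod_unfold measure_dyad_rectangle)
    show "set_integrable lebesgue (\<Union>a\<in>?I. ?X a) f"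
      unfolding R [symmetric]
      using dyad_rectangle_sets by (intro set_integrable_bounded[OF f] bounded_Times bounded_dyad) auto
    fix a assume a: "a \<in> ?I"
    have "?X a \<inter> A \<noteq> {}"
    proof
      assume "?X a \<inter> A = {}"
      then have "?X a \<subseteq> dyad m i \<times> dyad k j - A" using a R by blast
      then have "emeasure lebesgue (?X a) \<le> emeasure lebesgue (dyad m i \<times> dyad k j - A)"
        using A(1) dyad_rectangle_sets by (intro emeasure_mono) auto
      with thin \<mu> show False by simp
    qed
    then obtain z where z: "z \<in> ?X a" "z \<in> A" by blast
    have "\<bar>average f (?X a) - f z\<bar> \<le> e"
      using A(2)[OF z(2)] z(1) mk \<Delta> by (auto simp: averages_close_def case_prod_unfold)
    with A(2)[OF z(2)] show "\<bar>average f (?X a) - c\<bar> \<le> 2 * e" by linarith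
  qed auto
  then show ?thesis by (simp only: R)
qed

text \<open>Letting \<open>c\<close> range over the rationals keeps the family of sets \<open>A c N\<close> countable, so that almost
every point is a strong density point of each member containing it, while every point at which the
averages converge still belongs to a member.\<close>

lemma AE_averages_close_all_levels:
  fixes f :: "real \<times> real \<Rightarrow> real"
  assumes f: "locally_integrable f"
    and conv: "AE x in lebesgue. \<forall>e>0. \<exists>N. averages_close \<Delta> f e N x"
    and gap: "\<And>m. m \<ge> K \<Longrightarrow> \<exists>p\<le>G. int (m + p) \<in> \<Delta>"
    and "e > 0"
  shows "AE x in lebesgue. \<exists>N. averages_close UNIV f (3 * e) N x"
proof -
  define A where "A c N = {x. \<bar>f x - c\<bar> \<le> e \<and> averages_close \<Delta> f e N x}" for c N
  have A: "A c N \<in> sets lebesgue" for c N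
    unfolding A_def by (rule sets_averages_close[OF locally_integrable_measurable[OF f]])
  \<comment> \<open>less than the proportion of a rectangle taken up by one piece, as a piece arises by refining
    each side at most \<open>G\<close> times\<close>
  define \<eta> :: real where "\<eta> = 1 / (2 * 2 ^ G * 2 ^ G)"
  have "\<eta> > 0" by (simp add: \<eta>_def)
  have "AE x in lebesgue. \<forall>c::rat. \<forall>N. x \<in> A (of_rat c) N \<longrightarrow>
      (\<exists>N'. \<forall>m\<ge>N'. \<forall>k\<ge>N'. \<forall>i j. x \<in> dyad m i \<times> dyad k j \<longrightarrow>
        emeasure lebesgue (dyad m i \<times> dyad k j - A (of_rat c) N) \<le> ennreal (\<eta> / 2 ^ m / 2 ^ k))"
    unfolding AE_all_countable using AE_strong_dyadic_density_lebesgue[OF A \<open>\<eta> > 0\<close>] by blast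
  with conv show ?thesis
  proof eventually_elim
    case (elim x)
    obtain N where N: "averages_close \<Delta> f e N x" using elim(1) \<open>e > 0\<close> by blast
    obtain c :: rat where "f x - e < of_rat c" "of_rat c < f x"
      using of_rat_dense[of "f x - e" "f x"] \<open>e > 0\<close> by auto
    then have c: "\<bar>f x - of_rat c\<bar> \<le> e" by linarith
    have xA: "x \<in> A (of_rat c) N" using N c by (simp add: A_def)
    then obtain N' where N': "\<And>m k i j. m \<ge> N' \<Longrightarrow> k \<ge> N' \<Longrightarrow> x \<in> dyad m i \<times> dyad k j \<Longrightarrow>
        emeasure lebesgue (dyad m i \<times> dyad k j - A (of_rat c) N) \<le> ennreal (\<eta> / 2 ^ m / 2 ^ k)"
      using elim(2) by blast
    have "\<bar>average f (dyad m i \<times> dyad k j) - f x\<bar> \<le> 3 * e"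
      if mk: "m \<ge> max K (max N N')" "k \<ge> max K (max N N')" and x: "x \<in> dyad m i \<times> dyad k j" for m k i j
    proof -
      obtain p q where pq: "p \<le> G" "int (m + p) \<in> \<Delta>" "q \<le> G" "int (k + q) \<in> \<Delta>"
        using gap[of m] gap[of k] mk by auto
      have "(2::real) ^ p * 2 ^ q \<le> 2 ^ G * 2 ^ G"
        using pq by (intro mult_mono power_increasing) auto
      also have "\<dots> < 2 * 2 ^ G * 2 ^ G" by simp
      finally have "\<eta> < 1 / (2 ^ p * 2 ^ q)"
        unfolding \<eta>_def by (intro divide_strict_left_mono) auto
      then have "\<eta> / 2 ^ m / 2 ^ k < 1 / (2 ^ p * 2 ^ q) / 2 ^ m / 2 ^ k"
        by (intro divide_strict_right_mono) auto
      also have "\<dots> = 1 / 2 ^ (m + p) / 2 ^ (k + q)"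
        by (simp add: power_add mult_ac)
      finally have "\<eta> / 2 ^ m / 2 ^ k < 1 / 2 ^ (m + p) / 2 ^ (k + q)" .
      then have "ennreal (\<eta> / 2 ^ m / 2 ^ k) < ennreal (1 / 2 ^ (m + p) / 2 ^ (k + q))"
        by (intro ennreal_lessI) auto
      then have "\<bar>average f (dyad m i \<times> dyad k j) - of_rat c\<bar> \<le> 2 * e"
        using N'[OF _ _ x] mk pq
        by (intro average_near_if_pieces_meet[OF f A[of "of_rat c" N], where p = p and q = q])
          (auto simp: A_def intro: le_less_trans)
      with c show ?thesis by linarith
    qed
    then show ?case unfolding averages_close_def by blast
  qed
qed

lemma bounded_gaps_levels:
  fixes \<nu> :: "nat \<Rightarrow> int"
  assumes gap: "\<And>k. k \<ge> 1 \<Longrightarrow> \<nu> (k + 1) - \<nu> k \<le> int G"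
    and unbdd: "\<exists>k\<ge>1. int m \<le> \<nu> k" and m: "\<nu> 1 \<le> int m"
  shows "\<exists>p\<le>G. int (m + p) \<in> \<nu> ` {1..}"
proof -
  define k where "k = (LEAST k. k \<ge> 1 \<and> int m \<le> \<nu> k)"
  have k: "k \<ge> 1" "int m \<le> \<nu> k"
    using LeastI_ex[of "\<lambda>k. k \<ge> 1 \<and> int m \<le> \<nu> k"] unbdd by (auto simp: k_def)
  have "\<nu> k \<le> int (m + G)"
  proof (cases "k = 1")
    case True
    then show ?thesis using m by simp
  next
    case False
    then have "k - 1 \<ge> 1" "k - 1 < k" using k(1) by auto
    then have "\<nu> (k - 1) < int m"
      using not_less_Least[of "k - 1" "\<lambda>k. k \<ge> 1 \<and> int m \<le> \<nu> k"] by (auto simp: k_def)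
    then show ?thesis using gap[of "k - 1"] \<open>k - 1 \<ge> 1\<close> by auto
  qed
  moreover have "int (m + nat (\<nu> k - int m)) = \<nu> k" using k by simp
  ultimately show ?thesis
    using k by (intro exI[of _ "nat (\<nu> k - int m)"]) auto
qed

theorem theorem3p1:
  fixes \<nu> :: "nat \<Rightarrow> int" and \<Delta> :: "int set"
  assumes "\<And>k. k \<ge> 1 \<Longrightarrow> \<nu> k > 0"
    and "strict_mono_on {1..} \<nu>"
    and "\<Delta> = \<nu> ` {1..}"
    and "(SUP k\<in>{1..}. ereal (of_int (\<nu> (k + 1) - \<nu> k))) < \<infinity>"
  shows "differentiated_by (dyadic_rectangles \<Delta>) = differentiated_by (dyadic_rectangles UNIV)"
proof -
  have grow: "int k \<le> \<nu> k" if "k \<ge> 1" for k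
    using that
  proof (induction k rule: dec_induct)
    case base
    then show ?case using assms(1)[of 1] by simp
  next
    case (step k)
    then have "\<nu> k < \<nu> (Suc k)" by (intro strict_mono_onD[OF assms(2)]) auto
    then show ?case using step.IH by simp
  qed
  have unbdd: "\<exists>k\<ge>1. n \<le> \<nu> k" for n
    using grow[of "max 1 (nat n)"] by (intro exI[of _ "max 1 (nat n)"]) auto
  then have basis: "\<exists>m\<in>\<Delta>. n \<le> m" for n using assms(3) by auto
  have basis': "\<exists>m\<in>UNIV. n \<le> m" for n :: int by auto
  obtain G :: nat where S: "(SUP k\<in>{1..}. ereal (of_int (\<nu> (k + 1) - \<nu> k))) < ereal (real G)"
    using assms(4) less_PInf_Ex_of_nat by auto
  have G: "\<nu> (k + 1) - \<nu> k \<le> int G" if "k \<ge> 1" for k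
  proof -
    have "ereal (of_int (\<nu> (k + 1) - \<nu> k)) < ereal (real G)"
      using that by (intro le_less_trans[OF SUP_upper S]) auto
    then show ?thesis by simp
  qed
  have levels: "\<exists>p\<le>G. int (m + p) \<in> \<Delta>" if "m \<ge> nat (\<nu> 1)" for m
    unfolding assms(3) using that by (intro bounded_gaps_levels G unbdd) auto
  have "(AE x in lebesgue. osc (dyadic_rectangles \<Delta>) x f = 0) \<longleftrightarrow>
        (AE x in lebesgue. osc (dyadic_rectangles UNIV) x f = 0)" if f: "locally_integrable f" for f
    unfolding osc_dyadic_eq_0_iff[OF basis] osc_dyadic_eq_0_iff[OF basis']
  proof
    assume "AE x in lebesgue. \<forall>e>0. \<exists>N. averages_close UNIV f e N x"
    then show "AE x in lebesgue. \<forall>e>0. \<exists>N. averages_close \<Delta> f e N x"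
      by (rule eventually_mono) (unfold averages_close_def, blast)
  next
    assume conv: "AE x in lebesgue. \<forall>e>0. \<exists>N. averages_close \<Delta> f e N x"
    have "AE x in lebesgue. \<forall>t. \<exists>N. averages_close UNIV f (3 * inverse (real (Suc t))) N x"
      unfolding AE_all_countable
      using AE_averages_close_all_levels[OF f conv levels] by simp
    then show "AE x in lebesgue. \<forall>e>0. \<exists>N. averages_close UNIV f e N x"
    proof (eventually_elim, intro allI impI)
      fix x and e :: real
      assume *: "\<forall>t. \<exists>N. averages_close UNIV f (3 * inverse (real (Suc t))) N x" and "e > 0"
      then obtain t where "inverse (real (Suc t)) < e / 3"
        using reals_Archimedean[of "e / 3"] by auto
      moreover obtain N where "averages_close UNIV f (3 * inverse (real (Suc t))) N x" using * by blast
      ultimately have "averages_close UNIV f e N x" by (fastforce simp: averages_close_def)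
      then show "\<exists>N. averages_close UNIV f e N x" ..
    qed
  qed
  then show ?thesis unfolding differentiated_by_def by blast
qed

end
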